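(* Consider a symmetric graph optimization problem on weighted complete graphs (as defined in the context), where the edge-weight variables $\mathbf X^n=\{X_{n,e}:e\in E_n\}$ are i.i.d. with common distribution $\mathcal P$ with density $f$ supported on $[0,\infty)$, having finite mean and satisfying the rejection assumption of the context. Then this optimization problem (minimize $\sum_{e\in E(G)}X_{n,e}$ over $G\in\mathcal G_n$) is stable under small perturbations with perturbation blocks $\mathcal J_n=\{J_{n,e}:e\in E_n\}$, where $J_{n,e}=\{e\}$ for all $e\in E_n$.
   Context: Symmetric graph optimization problem on a weighted complete graph: $p_n\in\mathbb N$ with $p_n\uparrow\infty$; $E_n=\{\{i,j\}:i,j\in[p_n],\ i\ne j\}$ is the edge set of the complete graph on $[p_n]=\{1,\dots,p_n\}$; $X_{n,e}$ is the weight of edge $e\in E_n$; $\mathcal G_n$ is a non-empty collection of graphs with vertex set $[p_n]$ such that (a) $\sup_{n\ge1}\sup_{G\in\mathcal G_n}\operatorname{card}(E(G))/p_n<\infty$, where $E(G)$ is the edge set of $G$, and (b) $\mathcal G_n$ is invariant under permutations: if $G\in\mathcal G_n$ and $\pi$ is a permutation of $[p_n]$ then $\pi(G)\in\mathcal G_n$, where $\pi(G)$ has edge set $\{\{\pi(i),\pi(j)\}:\{i,j\}\in E(G)\}$. The problem is to minimize $\sum_{e\in E(G)}X_{n,e}$ over $G\in\mathcal G_n$. The space $\mathcal G_n$ has metric $d_n(G_1,G_2)=\frac1{p_n}\operatorname{card}(E(G_1)\,\Delta\,E(G_2))$. The minimizer is almost surely unique, denoted $\widehat G_n(\mathbf X^n)$.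 The input index set is $I_n=E_n$. Rejection assumption: for $X\sim\mathcal P$ and $W\sim N(0,1)$ independent and any $p,s\ge0$, $\mathbb E\bigl[|W|^p\bigl(1-f(X+sW)/f(X)\bigr)_+\bigr]\le C(f,p)\,s$, with $C(f,p)$ a finite positive constant depending only on $f$ and $p$. Stability. $\mathcal J_n=\{J_{n,l}:l\in\mathcal L_n\}$ is a finite family of subsets of $I_n$ with union $I_n$; $m_n=\operatorname{card}(\mathcal L_n)$. For each $l$, $\mathbf X^{n,l}$ is an independent copy of $\mathbf X^n$ (no further assumption on the joint law over $l$), and $\mathbf X^n_l$ is $\mathbf X^n$ with the coordinates in $J_{n,l}$ replaced by those of $\mathbf X^{n,l}$. For a metric $\mathsf d$, $P(T,\mathsf d,\varepsilon)$ is the largest cardinality of a subset of $T$ with pairwise distances $>\varepsilon$. With $\mathcal O_{n,A}=\{\widehat G_n(\mathbf X^n_l):l\in A\}$, the sequence is stable under small perturbations with perturbation blocks $\mathcal J_n$ if for any $\varepsilon,\delta>0$ there is $M(\varepsilon,\delta)<\infty$ with $\limsup_{n\to\infty}\mathbb P[\min_{A\subseteq\mathcal L_n:|A|>(1-\varepsilon)m_n}P(\mathcal O_{n,A},d_n,\varepsilon)\ge M(\varepsilon,\delta)]\le\delta$. *)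

theory Defs
  imports "HOL-Probability.Probability"
begin

section \<open>Stability under small perturbations\<close>

text \<open>
  A random vector is a family \<open>X i \<omega>\<close> of real random variables, of which only the
  coordinates \<open>i \<in> I\<close> matter.  Nothing is said here about several copies jointly.
\<close>

definition independent_copy ::
    "'a measure \<Rightarrow> 'i set \<Rightarrow> ('i \<Rightarrow> 'a \<Rightarrow> real) \<Rightarrow> ('i \<Rightarrow> 'a \<Rightarrow> real) \<Rightarrow> bool" where
  "independent_copy M I X Y \<longleftrightarrow>
     prob_space.indep_var M
       (PiM I (\<lambda>_. borel)) (\<lambda>\<omega>. \<lambda>i\<in>I. X i \<omega>)
       (PiM I (\<lambda>_. borel)) (\<lambda>\<omega>. \<lambda>i\<in>I. Y i \<omega>) \<and>
     distr M (PiM I (\<lambda>_. borel)) (\<lambda>\<omega>. \<lambda>i\<in>I. Y i \<omega>) =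
     distr M (PiM I (\<lambda>_. borel)) (\<lambda>\<omega>. \<lambda>i\<in>I. X i \<omega>)"

text \<open>\<open>Max\<close> makes this meaningful for finite \<open>T\<close> only, which suffices below.\<close>

definition packing_number :: "'g set \<Rightarrow> ('g \<Rightarrow> 'g \<Rightarrow> real) \<Rightarrow> real \<Rightarrow> nat" where
  "packing_number T d \<epsilon> =
     Max {card S | S. S \<subseteq> T \<and> (\<forall>x\<in>S. \<forall>y\<in>S. x \<noteq> y \<longrightarrow> d x y > \<epsilon>)}"

text \<open>
  \<open>L n\<close> is the finite label set of the blocks \<open>J n l\<close>, \<open>X n\<close> the input, \<open>Y n l\<close> the
  independent copy belonging to \<open>l\<close>, and \<open>opt n\<close> maps an input to the optimizer.
\<close>

definition perturbed_optimizer ::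
    "('i \<Rightarrow> 'a \<Rightarrow> real) \<Rightarrow> ('l \<Rightarrow> 'i \<Rightarrow> 'a \<Rightarrow> real) \<Rightarrow> ('l \<Rightarrow> 'i set) \<Rightarrow>
     (('i \<Rightarrow> real) \<Rightarrow> 'g) \<Rightarrow> 'a \<Rightarrow> 'l \<Rightarrow> 'g" where
  "perturbed_optimizer X Y J opt \<omega> l =
     opt (override_on (\<lambda>i. X i \<omega>) (\<lambda>i. Y l i \<omega>) (J l))"

text \<open>
  In the definition below, the minimum is over a nonempty family as soon as \<open>L n \<noteq> {}\<close>,
  as \<open>A = L n\<close> is then admissible.
\<close>

definition stable_under_small_perturbations ::
    "(nat \<Rightarrow> 'a measure) \<Rightarrow> (nat \<Rightarrow> 'i \<Rightarrow> 'a \<Rightarrow> real) \<Rightarrow> (nat \<Rightarrow> 'l \<Rightarrow> 'i \<Rightarrow> 'a \<Rightarrow> real) \<Rightarrow>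
     (nat \<Rightarrow> 'l set) \<Rightarrow> (nat \<Rightarrow> 'l \<Rightarrow> 'i set) \<Rightarrow>
     (nat \<Rightarrow> 'g \<Rightarrow> 'g \<Rightarrow> real) \<Rightarrow> (nat \<Rightarrow> ('i \<Rightarrow> real) \<Rightarrow> 'g) \<Rightarrow> bool" where
  "stable_under_small_perturbations M X Y L J d opt \<longleftrightarrow>
     (\<forall>\<epsilon>>0. \<forall>\<delta>>0. \<exists>K::real.
        limsup (\<lambda>n. ereal (measure (M n)
          {\<omega> \<in> space (M n).
             real (MIN A \<in> {A. A \<subseteq> L n \<and> real (card A) > (1 - \<epsilon>) * real (card (L n))}.
               packing_number (perturbed_optimizer (X n) (Y n) (J n) (opt n) \<omega> ` A) (d n) \<epsilon>)
             \<ge> K})) \<le> ereal \<delta>)"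


section \<open>Symmetric graph optimization problems\<close>

definition complete_edges :: "nat \<Rightarrow> nat set set" where
  "complete_edges m = {{i, j} | i j. i \<in> {1..m} \<and> j \<in> {1..m} \<and> i \<noteq> j}"

text \<open>
  All graphs of the \<open>n\<close>-th problem have the vertex set \<open>{1..p n}\<close>, so a graph is
  represented by its edge set, a subset of \<open>complete_edges (p n)\<close>.
\<close>

definition symmetric_graph_problem :: "(nat \<Rightarrow> nat) \<Rightarrow> (nat \<Rightarrow> nat set set set) \<Rightarrow> bool" where
  "symmetric_graph_problem p \<G> \<longleftrightarrow>
     incseq p \<and> filterlim p at_top sequentially \<and>
     (\<forall>n. \<G> n \<noteq> {} \<and> \<G> n \<subseteq> Pow (complete_edges (p n))) \<and>
     (\<exists>B::real. \<forall>n. \<forall>G\<in>\<G> n. real (card G) / real (p n) \<le> B) \<and>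
     (\<forall>n. \<forall>G\<in>\<G> n. \<forall>\<pi>. \<pi> permutes {1..p n} \<longrightarrow> (\<lambda>e. \<pi> ` e) ` G \<in> \<G> n)"

definition graph_dist :: "nat \<Rightarrow> nat set set \<Rightarrow> nat set set \<Rightarrow> real" where
  "graph_dist m G H = real (card (sym_diff G H)) / real m"

text \<open>
  \<open>arg_min_on\<close> selects a minimizer also when there are several.  If the weights are
  independent with a density, this happens with probability zero only.
\<close>

definition optimal_graph :: "nat set set set \<Rightarrow> (nat set \<Rightarrow> real) \<Rightarrow> nat set set" where
  "optimal_graph \<G> x = arg_min_on (\<lambda>G. \<Sum>e\<in>G. x e) \<G>"


section \<open>The rejection assumption\<close>

text \<open>
  The product measure is the joint law of \<open>X\<close> with density \<open>f\<close> and an independent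
  standard normal \<open>W\<close>.  The conventions \<open>a / 0 = 0\<close> and \<open>0 powr 0 = 0\<close> only concern the
  null events \<open>f X = 0\<close> and \<open>W = 0\<close>.
\<close>

definition rejection_assumption :: "(real \<Rightarrow> real) \<Rightarrow> bool" where
  "rejection_assumption f \<longleftrightarrow>
     (\<forall>p\<ge>0. \<exists>C>0. \<forall>s\<ge>0.
        (\<integral>\<^sup>+ (x, w). ennreal (\<bar>w\<bar> powr p * max 0 (1 - f (x + s * w) / f x))
           \<partial>(density lborel (\<lambda>x. ennreal (f x)) \<Otimes>\<^sub>M
             density lborel (\<lambda>w. ennreal (std_normal_density w))))
        \<le> ennreal (C * s))"

end

theory Submission
  imports Defs
begin

text \<open>
  If an edge \<open>e\<close> is used neither by an optimizer \<open>G\<close> of the original weights nor by an optimizer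
  \<open>H\<close> of the weights perturbed at \<open>e\<close>, then the perturbation changes the weight of neither
  graph, so \<open>G\<close> and \<open>H\<close> are both optimal for the original weights and hence almost
  surely equal.  The perturbed weights have the same law as the original ones, so the expected number
  of edges used by one of the two optimizers is at most twice the maximal number of edges in a graph,
  which is \<open>O(p\<^sub>n)\<close> and negligible compared to the number of blocks.  By Markov's inequality, with
  high probability all but a fraction \<open>\<epsilon>\<close> of the perturbed optimizers coincide with the
  original one, and the packing number is at most one.
\<close>

section \<open>Minimizers, packing numbers and edge counts: deterministic facts\<close>

definition minimizers :: "'e set set \<Rightarrow> ('e \<Rightarrow> real) \<Rightarrow> 'e set set" where
  "minimizers \<G> x = {G \<in> \<G>. \<forall>H\<in>\<G>. sum x G \<le> sum x H}"

lemma optimal_graph_in_minimizers: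
  assumes "finite \<G>" "\<G> \<noteq> {}"
  shows "optimal_graph \<G> x \<in> minimizers \<G> x"
  using arg_min_if_finite[OF assms, of "sum x"]
  unfolding optimal_graph_def minimizers_def by (auto simp: not_less)

lemma minimizers_cong:
  assumes "\<G> \<subseteq> Pow E" "\<And>i. i \<in> E \<Longrightarrow> x i = y i"
  shows "minimizers \<G> x = minimizers \<G> y"
proof -
  have "sum x G = sum y G" if "G \<in> \<G>" for G
    using that assms by (intro sum.cong) auto
  then show ?thesis
    unfolding minimizers_def by auto
qed

text \<open>Graphs avoiding \<open>e\<close> have the same weight under \<open>x\<close> and
  \<open>y\<close>, so \<open>sum x H = sum y H \<le> sum y G = sum x G\<close>. Thus
  \<open>H\<close> costs no more under \<open>x\<close> than the minimizer \<open>G\<close>.\<close>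

lemma minimizers_perturb_unused:
  assumes eq: "\<And>i. i \<noteq> e \<Longrightarrow> x i = y i"
    and G: "G \<in> minimizers \<G> x" "e \<notin> G" and H: "H \<in> minimizers \<G> y" "e \<notin> H"
  shows "H \<in> minimizers \<G> x"
proof -
  have "sum x G = sum y G" "sum x H = sum y H"
    using eq G(2) H(2) by (metis sum.cong)+
  then show ?thesis
    using G(1) H(1) unfolding minimizers_def by fastforce
qed

lemma packing_number_subsingleton:
  assumes "T \<subseteq> {g}"
  shows "packing_number T d \<epsilon> \<le> 1"
proof -
  let ?C = "{card S | S. S \<subseteq> T \<and> (\<forall>x\<in>S. \<forall>y\<in>S. x \<noteq> y \<longrightarrow> d x y > \<epsilon>)}"
  have le: "c \<le> 1" if "c \<in> ?C" for c
    using that assms card_mono[of "{g}"] by fastforce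
  then have "finite ?C"
    by (intro finite_subset[of ?C "{..1}"]) (auto simp only: atMost_iff)
  \<comment> \<open>\<open>Max\<close> is only meaningful on a finite nonempty set; the empty
    packing supplies an element whatever \<open>T\<close> and \<open>d\<close> are.\<close>
  moreover have "card ({} :: 'a set) \<in> ?C"
    by blast
  ultimately show ?thesis
    unfolding packing_number_def using le by (subst Max_le_iff) auto
qed

text \<open>The labels \<open>l\<close> with \<open>h l = g\<close> form an admissible
  \<open>A\<close>: the strict bound on the remaining labels is exactly the strict inequality
  required of \<open>card A\<close>. The image of this \<open>A\<close> has at most one point, so
  neither the choice of \<open>d\<close> nor the packing radius matters.\<close>

lemma Min_packing_number_le_1:
  fixes \<epsilon> :: real
  assumes "finite L" and few: "real (card {l \<in> L. h l \<noteq> g}) < \<epsilon> * real (card L)"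
  shows "(MIN A \<in> {A. A \<subseteq> L \<and> real (card A) > (1 - \<epsilon>) * real (card L)}.
            packing_number (h ` A) d \<epsilon>) \<le> 1"
proof -
  let ?A = "{l \<in> L. h l = g}"
  let ?F = "{A. A \<subseteq> L \<and> real (card A) > (1 - \<epsilon>) * real (card L)}"
  have "card L = card ?A + card {l \<in> L. h l \<noteq> g}"
    using assms(1) by (subst card_Un_disjoint[symmetric]) (auto intro: arg_cong[where f = card])
  then have "?A \<in> ?F"
    using few by (auto simp: algebra_simps)
  moreover have "finite ?F"
    using assms(1) by auto
  ultimately have "(MIN A \<in> ?F. packing_number (h ` A) d \<epsilon>) \<le> packing_number (h ` ?A) d \<epsilon>"
    by (intro Min_le imageI finite_imageI)
  also have "\<dots> \<le> 1"
    by (rule packing_number_subsingleton[of _ g]) auto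
  finally show ?thesis .
qed

lemma finite_complete_edges: "finite (complete_edges m)"
  by (rule finite_subset[of _ "Pow {1..m}"]) (auto simp: complete_edges_def)

lemma card_complete_edges: "card (complete_edges m) = m choose 2"
proof -
  have "complete_edges m = {K. K \<subseteq> {1..m} \<and> card K = 2}"
    unfolding complete_edges_def card_2_iff by blast
  then show ?thesis
    using n_subsets[of "{1..m}" 2] by simp
qed

section \<open>The law of the weights after resampling one coordinate\<close>

context prob_space
begin

lemma prob_restrict_PiE:
  fixes X :: "'i \<Rightarrow> 'a \<Rightarrow> real"
  assumes "finite I" "I \<noteq> {}" "indep_vars (\<lambda>_. borel) X I" "\<And>i. i \<in> I \<Longrightarrow> B i \<in> sets borel"
  shows "prob ((\<lambda>\<omega>. \<lambda>i\<in>I. X i \<omega>) -` Pi\<^sub>E I B \<inter> space M) = (\<Prod>i\<in>I. prob (X i -` B i \<inter> space M))"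
proof -
  have "(\<lambda>\<omega>. \<lambda>i\<in>I. X i \<omega>) -` Pi\<^sub>E I B \<inter> space M = (\<Inter>i\<in>I. X i -` B i \<inter> space M)"
    using assms(2) by (auto simp: PiE_iff)
  then show ?thesis
    using indep_varsD_finite[OF assms(3,2,1), of B] assms(4) by simp
qed

text \<open>A law on a finite product is determined by its values on boxes. For a box, the event for
  the resampled vector splits into one about \<open>X\<close> that ignores coordinate
  \<open>e\<close> and one about \<open>Y\<close> that sees only \<open>e\<close>. Independence of
  \<open>X\<close> and \<open>Y\<close>, equality of their laws, and independence of the coordinates
  of \<open>X\<close> turn this into the product of the marginals.\<close>

lemma distr_override_independent_copy:
  fixes X Y :: "'i \<Rightarrow> 'a \<Rightarrow> real"
  assumes I: "finite I" "e \<in> I" and indep: "indep_vars (\<lambda>_. borel) X I"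
    and copy: "independent_copy M I X Y"
  shows "distr M (PiM I (\<lambda>_. borel)) (\<lambda>\<omega>. \<lambda>i\<in>I. override_on (\<lambda>i. X i \<omega>) (\<lambda>i. Y i \<omega>) {e} i) =
         distr M (PiM I (\<lambda>_. borel)) (\<lambda>\<omega>. \<lambda>i\<in>I. X i \<omega>)" (is "distr M ?P ?Z = distr M ?P ?X")
    and "i \<in> I \<Longrightarrow> (\<lambda>\<omega>. override_on (\<lambda>i. X i \<omega>) (\<lambda>i. Y i \<omega>) {e} i) \<in> borel_measurable M"
proof -
  let ?Y = "\<lambda>\<omega>. \<lambda>i\<in>I. Y i \<omega>"
  have indepXY: "indep_var ?P ?X ?P ?Y" and distrY: "distr M ?P ?Y = distr M ?P ?X"
    using copy unfolding independent_copy_def by auto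
  have ne: "I \<noteq> {}"
    using I(2) by auto
  have mX: "?X \<in> measurable M ?P" and mY: "?Y \<in> measurable M ?P"
    using indepXY indep_var_rv1 indep_var_rv2 by blast+
  have "(\<lambda>\<omega>. ?Y \<omega> e) \<in> borel_measurable M"
    using measurable_compose[OF mY measurable_component_singleton[OF I(2)]] .
  then have Ye: "Y e \<in> borel_measurable M"
    using I(2) by simp
  have Xi: "X i \<in> borel_measurable M" if "i \<in> I" for i
    using indep that unfolding indep_vars_def by auto
  show Zi: "(\<lambda>\<omega>. override_on (\<lambda>i. X i \<omega>) (\<lambda>i. Y i \<omega>) {e} i) \<in> borel_measurable M" if "i \<in> I" for i
    using Xi[OF that] Ye by (cases "i = e") (auto simp: override_on_def)
  have mZ: "?Z \<in> measurable M ?P"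
    by (intro measurable_restrict Zi)
  interpret D: prob_space "distr M ?P ?Z"
    by (rule prob_space_distr[OF mZ])
  show "distr M ?P ?Z = distr M ?P ?X"
  proof (rule measure_eqI_PiM_finite[OF I(1)])
    fix A :: "'i \<Rightarrow> real set"
    assume A: "\<And>i. i \<in> I \<Longrightarrow> A i \<in> sets borel"
    \<comment> \<open>\<open>B\<close> drops the constraint at \<open>e\<close> and \<open>C\<close>
      keeps only that one, so the event for the resampled vector is a rectangle for the independent
      pair of \<open>X\<close> and \<open>Y\<close>.\<close>
    define B where "B = (\<lambda>i. if i = e then UNIV else A i)"
    define C where "C = (\<lambda>i. if i = e then A i else UNIV)"
    have BC: "B i \<in> sets borel" "C i \<in> sets borel" if "i \<in> I" for i
      using A[OF that] by (auto simp: B_def C_def)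
    have PA: "Pi\<^sub>E I A \<in> sets ?P" and PB: "Pi\<^sub>E I B \<in> sets ?P" and PC: "Pi\<^sub>E I C \<in> sets ?P"
      using A BC I(1) by (auto intro!: sets_PiM_I_finite)
    have "?Z -` Pi\<^sub>E I A \<inter> space M = (\<lambda>\<omega>. (?X \<omega>, ?Y \<omega>)) -` (Pi\<^sub>E I B \<times> Pi\<^sub>E I C) \<inter> space M"
      proof (rule set_eqI)
      fix \<omega>
      have "(\<forall>i\<in>I. override_on (\<lambda>i. X i \<omega>) (\<lambda>i. Y i \<omega>) {e} i \<in> A i) \<longleftrightarrow>
          (\<forall>i\<in>I. X i \<omega> \<in> B i) \<and> (\<forall>i\<in>I. Y i \<omega> \<in> C i)"
        unfolding B_def C_def override_on_def by (smt (verit) UNIV_I singleton_iff)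
      then show "\<omega> \<in> ?Z -` Pi\<^sub>E I A \<inter> space M \<longleftrightarrow>
          \<omega> \<in> (\<lambda>\<omega>. (?X \<omega>, ?Y \<omega>)) -` (Pi\<^sub>E I B \<times> Pi\<^sub>E I C) \<inter> space M"
        by (auto simp: PiE_iff)
    qed
    then have "prob (?Z -` Pi\<^sub>E I A \<inter> space M) =
        prob (?X -` Pi\<^sub>E I B \<inter> space M) * prob (?Y -` Pi\<^sub>E I C \<inter> space M)"
      using indep_varD[OF indepXY PB PC] by simp
    also have "prob (?Y -` Pi\<^sub>E I C \<inter> space M) = prob (?X -` Pi\<^sub>E I C \<inter> space M)"
      using measure_distr[OF mY PC] measure_distr[OF mX PC] distrY by simp
    also have "prob (?X -` Pi\<^sub>E I B \<inter> space M) * prob (?X -` Pi\<^sub>E I C \<inter> space M) =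
        (\<Prod>i\<in>I. prob (X i -` B i \<inter> space M) * prob (X i -` C i \<inter> space M))"
      using prob_restrict_PiE[OF I(1) ne indep, of B] prob_restrict_PiE[OF I(1) ne indep, of C] BC
      by (simp add: prod.distrib)
    \<comment> \<open>At every index one of the two factors belongs to \<open>UNIV\<close> and
      equals 1: the first at \<open>e\<close>, the second elsewhere.\<close>
    also have "\<dots> = (\<Prod>i\<in>I. prob (X i -` A i \<inter> space M))"
      by (intro prod.cong) (auto simp: B_def C_def prob_space)
    also have "\<dots> = prob (?X -` Pi\<^sub>E I A \<inter> space M)"
      using prob_restrict_PiE[OF I(1) ne indep, of A] A by simp
    finally show "emeasure (distr M ?P ?Z) (Pi\<^sub>E I A) = emeasure (distr M ?P ?X) (Pi\<^sub>E I A)"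
      by (simp only: emeasure_distr[OF mX PA] emeasure_distr[OF mZ PA] emeasure_eq_measure)
  next
    \<comment> \<open>The criterion asks for a countable cover of the space by boxes of finite
      measure; as the laws are probabilities, the whole space repeated will do.\<close>
    show "range (\<lambda>_::nat. \<Pi>\<^sub>E i\<in>I. UNIV) \<subseteq> prod_algebra I (\<lambda>_. borel :: real measure)"
      using prod_algebraI_finite[OF I(1), of "\<lambda>_. UNIV" "\<lambda>_. borel :: real measure"] by auto
  qed (auto simp: space_PiM)
qed

section \<open>Almost sure uniqueness of the minimizer\<close>

lemma AE_indep_sum_neq_0:
  fixes U V :: "'a \<Rightarrow> real"
  assumes indep: "indep_var borel U borel V" and no_atom: "\<And>c. prob {\<omega> \<in> space M. U \<omega> = c} = 0"
  shows "AE \<omega> in M. U \<omega> + V \<omega> \<noteq> 0"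
proof -
  have [measurable]: "U \<in> borel_measurable M" "V \<in> borel_measurable M"
    using indep indep_var_rv1 indep_var_rv2 by blast+
  interpret DU: prob_space "distr M borel U" by (rule prob_space_distr) simp
  interpret DV: prob_space "distr M borel V" by (rule prob_space_distr) simp
  interpret DUV: pair_sigma_finite "distr M borel U" "distr M borel V" ..
  \<comment> \<open>For fixed \<open>v\<close> the exceptional event is that \<open>U\<close> hits
    the single value \<open>-v\<close>, which is null as \<open>U\<close> has no atoms. Fubini on
    the product of the two laws then handles random \<open>v\<close>, with no condition on the law
    of \<open>V\<close>.\<close>
  have "AE u in distr M borel U. u + v \<noteq> 0" for v
  proof -
    have "emeasure M {\<omega> \<in> space M. \<not> U \<omega> + v \<noteq> 0} = 0"
      using no_atom[of "-v"] by (simp add: emeasure_eq_measure eq_neg_iff_add_eq_0)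
    then have "AE \<omega> in M. U \<omega> + v \<noteq> 0"
      by (intro AE_I[where N = "{\<omega> \<in> space M. \<not> U \<omega> + v \<noteq> 0}"]) auto
    then show ?thesis
      by (subst AE_distr_iff) auto
  qed
  moreover have meas: "{z \<in> space (distr M borel U \<Otimes>\<^sub>M distr M borel V). fst z + snd z \<noteq> 0}
      \<in> sets (distr M borel U \<Otimes>\<^sub>M distr M borel V)"
    by measurable
  ultimately have "AE u in distr M borel U. AE v in distr M borel V. u + v \<noteq> 0"
    by (subst DUV.AE_commute) simp_all
  then have "AE z in distr M borel U \<Otimes>\<^sub>M distr M borel V. fst z + snd z \<noteq> 0"
    by (intro DUV.AE_pair_measure meas) simp
  then have "AE z in distr M (borel \<Otimes>\<^sub>M borel) (\<lambda>\<omega>. (U \<omega>, V \<omega>)). fst z + snd z \<noteq> 0"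
    using indep[unfolded indep_var_distribution_eq] by (elim conjE) (simp only:)
  then show ?thesis
    by (subst (asm) AE_distr_iff) auto
qed

text \<open>The difference of the two sums is a linear combination of the \<open>X i\<close> with
  coefficients in {-1, 0, 1}. Some \<open>e\<close> in the symmetric difference has a nonzero
  coefficient; its term is atomless and independent of the remaining terms, so the total is almost
  surely nonzero.\<close>

lemma AE_sum_neq:
  fixes X :: "'i \<Rightarrow> 'a \<Rightarrow> real"
  assumes E: "finite E" and indep: "indep_vars (\<lambda>_. borel) X E"
    and no_atom: "\<And>i c. i \<in> E \<Longrightarrow> prob {\<omega> \<in> space M. X i \<omega> = c} = 0"
    and GH: "G \<subseteq> E" "H \<subseteq> E" "G \<noteq> H"
  shows "AE \<omega> in M. (\<Sum>i\<in>G. X i \<omega>) \<noteq> (\<Sum>i\<in>H. X i \<omega>)"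
proof -
  define c :: "'i \<Rightarrow> real" where "c i = of_bool (i \<in> G) - of_bool (i \<in> H)" for i
  obtain e where e: "e \<in> E" "c e \<noteq> 0"
    proof -
    obtain e where "e \<in> G \<longleftrightarrow> e \<notin> H"
      using GH(3) by blast
    then show thesis
      using that[of e] GH(1,2) by (auto simp: c_def)
  qed
  have "indep_vars (\<lambda>_. borel) (\<lambda>i \<omega>. c i * X i \<omega>) (insert e (E - {e}))"
    using indep_vars_compose2[OF indep, of "\<lambda>i x. c i * x"] e by (simp add: insert_absorb)
  then have "indep_var borel (\<lambda>\<omega>. c e * X e \<omega>) borel (\<lambda>\<omega>. \<Sum>i\<in>E - {e}. c i * X i \<omega>)"
    using E by (intro indep_vars_sum) auto
  moreover have "{\<omega> \<in> space M. c e * X e \<omega> = a} = {\<omega> \<in> space M. X e \<omega> = a / c e}" for a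
    using e by (auto simp: field_simps)
  ultimately have "AE \<omega> in M. c e * X e \<omega> + (\<Sum>i\<in>E - {e}. c i * X i \<omega>) \<noteq> 0"
    using no_atom[OF e(1)] by (intro AE_indep_sum_neq_0) auto
  moreover have "c e * X e \<omega> + (\<Sum>i\<in>E - {e}. c i * X i \<omega>) = (\<Sum>i\<in>G. X i \<omega>) - (\<Sum>i\<in>H. X i \<omega>)" for \<omega>
  proof -
    have "c e * X e \<omega> + (\<Sum>i\<in>E - {e}. c i * X i \<omega>) = (\<Sum>i\<in>E. c i * X i \<omega>)"
      using sum.remove[OF E e(1), of "\<lambda>i. c i * X i \<omega>"] by simp
    also have "\<dots> = (\<Sum>i\<in>E. if i \<in> G then X i \<omega> else 0) - (\<Sum>i\<in>E. if i \<in> H then X i \<omega> else 0)"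
      unfolding sum_subtractf[symmetric] by (intro sum.cong) (auto simp: c_def)
    finally show ?thesis
      using E GH by (simp add: sum.inter_restrict[symmetric] Int_absorb1)
  qed
  ultimately show ?thesis
    by simp
qed

text \<open>Two distinct minimizers would have equal weight, and there are only finitely many pairs
  of graphs, each tied with probability zero.\<close>

lemma AE_unique_minimizer:
  fixes X :: "'i \<Rightarrow> 'a \<Rightarrow> real"
  assumes E: "finite E" and indep: "indep_vars (\<lambda>_. borel) X E"
    and no_atom: "\<And>i c. i \<in> E \<Longrightarrow> prob {\<omega> \<in> space M. X i \<omega> = c} = 0"
    and \<G>: "\<G> \<subseteq> Pow E"
  shows "AE \<omega> in M. \<forall>G\<in>minimizers \<G> (\<lambda>i. X i \<omega>). \<forall>H\<in>minimizers \<G> (\<lambda>i. X i \<omega>). G = H"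
proof -
  have fin: "finite \<G>"
    using E \<G> by (simp add: finite_subset)
  have "AE \<omega> in M. \<forall>G\<in>\<G>. \<forall>H\<in>\<G>. G \<noteq> H \<longrightarrow> (\<Sum>i\<in>G. X i \<omega>) \<noteq> (\<Sum>i\<in>H. X i \<omega>)"
    using \<G> by (intro AE_finite_allI fin AE_impI AE_sum_neq[OF E indep no_atom]) auto
  then show ?thesis
    proof eventually_elim
    case (elim \<omega>)
    show ?case
    proof (intro ballI)
      fix G H assume GH: "G \<in> minimizers \<G> (\<lambda>i. X i \<omega>)" "H \<in> minimizers \<G> (\<lambda>i. X i \<omega>)"
      then have "(\<Sum>i\<in>G. X i \<omega>) = (\<Sum>i\<in>H. X i \<omega>)"
        by (intro antisym) (auto simp: minimizers_def)
      then show "G = H"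
        using elim GH unfolding minimizers_def by blast
    qed
  qed
qed

section \<open>How many perturbed optimizers can differ from the original one\<close>

lemma perturbed_optimizers_differ_bound:
  fixes X :: "nat set \<Rightarrow> 'a \<Rightarrow> real" and Y :: "nat set \<Rightarrow> nat set \<Rightarrow> 'a \<Rightarrow> real"
  assumes E: "finite E" and indep: "indep_vars (\<lambda>_. borel) X E"
    and no_atom: "\<And>i c. i \<in> E \<Longrightarrow> prob {\<omega> \<in> space M. X i \<omega> = c} = 0"
    and copies: "\<And>e. e \<in> E \<Longrightarrow> independent_copy M E X (Y e)"
    and \<G>: "\<G> \<subseteq> Pow E" "\<G> \<noteq> {}" and b: "\<And>G. G \<in> \<G> \<Longrightarrow> real (card G) \<le> b" and t: "t > 0"
  shows "\<exists>N\<in>events. prob N \<le> 2 * b / t \<and> (\<forall>\<omega>\<in>space M - N.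
       real (card {e \<in> E. perturbed_optimizer X Y (\<lambda>e. {e}) (optimal_graph \<G>) \<omega> e
                     \<noteq> optimal_graph \<G> (\<lambda>i. X i \<omega>)}) < t)"
proof -
  let ?P = "PiM E (\<lambda>_. borel) :: (nat set \<Rightarrow> real) measure"
  define X' where "X' e \<omega> = override_on (\<lambda>i. X i \<omega>) (\<lambda>i. Y e i \<omega>) {e}" for e \<omega>
  \<comment> \<open>Quantifying over all minimizers makes usage of \<open>e\<close> a finite Boolean
    combination of comparisons between sums, hence measurable in the weights. No measurability of
    the choice made by \<open>optimal_graph\<close> is then needed.\<close>
  define used where "used e x \<longleftrightarrow> (\<exists>G\<in>minimizers \<G> x. e \<in> G)" for e and x :: "nat set \<Rightarrow> real"
  define U where "U e = {\<omega> \<in> space M. used e (\<lambda>i. X i \<omega>)}" for e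
  define U' where "U' e = {\<omega> \<in> space M. used e (X' e \<omega>)}" for e
  have fin: "finite \<G>"
    using E \<G> by (simp add: finite_subset)
  have Xi: "X i \<in> borel_measurable M" if "i \<in> E" for i
    using indep that unfolding indep_vars_def by auto
  have X'_distr: "distr M ?P (\<lambda>\<omega>. \<lambda>i\<in>E. X' e \<omega> i) = distr M ?P (\<lambda>\<omega>. \<lambda>i\<in>E. X i \<omega>)"
    and X'_meas: "\<And>i. i \<in> E \<Longrightarrow> (\<lambda>\<omega>. X' e \<omega> i) \<in> borel_measurable M" if "e \<in> E" for e
    using distr_override_independent_copy[OF E that indep copies[OF that]] unfolding X'_def by auto

  have S: "{x \<in> space ?P. used e x} \<in> sets ?P" for e
  proof -
    have [measurable]: "(\<lambda>x. sum x G) \<in> borel_measurable ?P" if "G \<in> \<G>" for G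
      using that \<G> by (intro borel_measurable_sum measurable_component_singleton) auto
    have "{x \<in> space ?P. used e x} =
      {x \<in> space ?P. \<exists>G\<in>{G\<in>\<G>. e \<in> G}. \<forall>H\<in>\<G>. sum x G \<le> sum x H}"
      by (auto simp: used_def minimizers_def)
    also have "\<dots> \<in> sets ?P"
      using fin by (intro sets.sets_Collect_finite_Ex sets.sets_Collect_finite_All' \<G>(2)
          borel_measurable_le) auto
    finally show ?thesis .
  qed
  have mX: "(\<lambda>\<omega>. \<lambda>i\<in>E. X i \<omega>) \<in> measurable M ?P"
    by (intro measurable_restrict Xi)
  have mX': "(\<lambda>\<omega>. \<lambda>i\<in>E. X' e \<omega> i) \<in> measurable M ?P" if "e \<in> E" for e
    using that by (intro measurable_restrict X'_meas)
  \<comment> \<open>Laws live on functions restricted to \<open>E\<close>, whereas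
    \<open>optimal_graph\<close> receives unrestricted weights; usage depends only on coordinates in
    \<open>E\<close>, so the two views agree.\<close>
  have used_restrict: "used e (restrict x E) \<longleftrightarrow> used e x" for e x
    unfolding used_def using minimizers_cong[OF \<G>(1), of "restrict x E" x] by simp
  have U_eq: "U e = (\<lambda>\<omega>. \<lambda>i\<in>E. X i \<omega>) -` {x \<in> space ?P. used e x} \<inter> space M" for e
    by (auto simp: U_def used_restrict space_PiM)
  have U'_eq: "U' e = (\<lambda>\<omega>. \<lambda>i\<in>E. X' e \<omega> i) -` {x \<in> space ?P. used e x} \<inter> space M" for e
    by (auto simp: U'_def used_restrict space_PiM)
  have U_sets: "U e \<in> events" for e
    unfolding U_eq by (rule measurable_sets[OF mX S])
  have U'_sets: "U' e \<in> events" if "e \<in> E" for e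
    unfolding U'_eq by (rule measurable_sets[OF mX'[OF that] S])
  \<comment> \<open>This is where equality in law enters: being used is a property of the weight
    vector alone.\<close>
  have prob_U': "prob (U' e) = prob (U e)" if "e \<in> E" for e
    unfolding U'_eq U_eq measure_distr[OF mX S, symmetric]
      measure_distr[OF mX'[OF that] S, symmetric] X'_distr[OF that] ..

  obtain N0 where N0: "N0 \<in> null_sets M"
    "\<And>\<omega> G H. \<omega> \<in> space M - N0 \<Longrightarrow> G \<in> minimizers \<G> (\<lambda>i. X i \<omega>) \<Longrightarrow>
       H \<in> minimizers \<G> (\<lambda>i. X i \<omega>) \<Longrightarrow> G = H"
    using AE_unique_minimizer[OF E indep no_atom \<G>(1)] by (auto elim!: AE_E3)
  \<comment> \<open>Off the null set of ties, \<open>U e\<close> occurs exactly when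
    \<open>e\<close> lies in the unique minimizer, so the sum of indicators is the number of its
    edges, at most \<open>b\<close>.\<close>
  have "(\<Sum>e\<in>E. prob (U e)) = (\<integral>\<omega>. (\<Sum>e\<in>E. indicator (U e) \<omega>) \<partial>M)"
    using U_sets by (subst Bochner_Integration.integral_sum) (auto simp: emeasure_eq_measure)
  also have "\<dots> \<le> (\<integral>\<omega>. b \<partial>M)"
  proof (rule integral_mono_AE)
    show "AE \<omega> in M. (\<Sum>e\<in>E. indicator (U e) \<omega>) \<le> b"
    proof (rule AE_I'[OF N0(1)], rule subsetI, rule ccontr)
      fix \<omega> assume \<omega>: "\<omega> \<in> {\<omega> \<in> space M. \<not> (\<Sum>e\<in>E. indicator (U e) \<omega>) \<le> b}" "\<omega> \<notin> N0"
      define G where "G = optimal_graph \<G> (\<lambda>i. X i \<omega>)"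
      have G: "G \<in> minimizers \<G> (\<lambda>i. X i \<omega>)"
        unfolding G_def by (rule optimal_graph_in_minimizers[OF fin \<G>(2)])
      then have "\<omega> \<in> U e \<longleftrightarrow> e \<in> G" for e
        using N0(2)[of \<omega> G] \<omega> unfolding U_def used_def by blast
      then have "indicator (U e) \<omega> = (indicator G e :: real)" for e
        by (simp add: indicator_def)
      then have "(\<Sum>e\<in>E. indicator (U e) \<omega>) = real (card (E \<inter> G))"
        using E by (simp add: indicator_def sum_of_bool_eq)
      moreover have "E \<inter> G = G" "G \<in> \<G>"
        using G \<G> by (auto simp: minimizers_def)
      ultimately show False
        using b[of G] \<omega> by simp
    qed
  qed (use U_sets in \<open>auto simp: emeasure_eq_measure\<close>)
  finally have sum_U: "(\<Sum>e\<in>E. prob (U e)) \<le> b"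
    by (simp add: prob_space)

  \<comment> \<open>\<open>Z\<close> will dominate the number of labels whose optimizer changes,
    since each such label lies in \<open>U e\<close> or \<open>U' e\<close>. Its mean is at most
    \<open>2 * b\<close>, so Markov's inequality gives the stated bound.\<close>
  define Z where "Z \<omega> = (\<Sum>e\<in>E. indicator (U e) \<omega> + indicator (U' e) \<omega> :: real)" for \<omega>
  have Z_int: "integrable M Z"
    unfolding Z_def using U_sets U'_sets
    by (intro Bochner_Integration.integrable_sum Bochner_Integration.integrable_add)
      (auto simp: emeasure_eq_measure)
  have "(\<integral>\<omega>. Z \<omega> \<partial>M) = (\<Sum>e\<in>E. prob (U e) + prob (U' e))"
    unfolding Z_def using U_sets U'_sets
    by (subst Bochner_Integration.integral_sum) (auto simp: emeasure_eq_measure)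
  also have "\<dots> \<le> 2 * b"
    using sum_U prob_U' by (simp add: sum_distrib_left[symmetric])
  finally have "(\<integral>\<omega>. Z \<omega> \<partial>M) / t \<le> 2 * b / t"
    using t by (simp add: divide_right_mono)
  moreover have "prob {\<omega> \<in> space M. Z \<omega> \<ge> t} \<le> (\<integral>\<omega>. Z \<omega> \<partial>M) / t"
    by (rule integral_Markov_inequality_measure[OF Z_int sets.top _ t])
      (simp add: Z_def sum_nonneg)
  ultimately have "prob {\<omega> \<in> space M. Z \<omega> \<ge> t} \<le> 2 * b / t"
    by linarith
  moreover have Zs: "{\<omega> \<in> space M. Z \<omega> \<ge> t} \<in> events"
    using Z_int by measurable
  ultimately have "prob (N0 \<union> {\<omega> \<in> space M. Z \<omega> \<ge> t}) \<le> 2 * b / t"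
    using N0(1) measure_Un_null_set by (metis sup_commute)
  moreover have "real (card {e \<in> E. perturbed_optimizer X Y (\<lambda>e. {e}) (optimal_graph \<G>) \<omega> e
                     \<noteq> optimal_graph \<G> (\<lambda>i. X i \<omega>)}) < t" (is "real (card ?D) < t")
    if \<omega>: "\<omega> \<in> space M - (N0 \<union> {\<omega> \<in> space M. Z \<omega> \<ge> t})" for \<omega>
  proof -
    have "\<omega> \<in> U e \<or> \<omega> \<in> U' e" if "e \<in> ?D" for e
    proof (rule ccontr)
      let ?G = "optimal_graph \<G> (\<lambda>i. X i \<omega>)" and ?H = "optimal_graph \<G> (X' e \<omega>)"
      assume "\<not> (\<omega> \<in> U e \<or> \<omega> \<in> U' e)"
      moreover have G: "?G \<in> minimizers \<G> (\<lambda>i. X i \<omega>)" and H: "?H \<in> minimizers \<G> (X' e \<omega>)"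
        by (rule optimal_graph_in_minimizers[OF fin \<G>(2)])+
      ultimately have e: "e \<notin> ?G" "e \<notin> ?H"
        using \<omega> by (auto simp: U_def U'_def used_def)
      have "?H \<in> minimizers \<G> (\<lambda>i. X i \<omega>)"
        by (rule minimizers_perturb_unused[OF _ G e(1) H e(2)]) (simp add: X'_def override_on_def)
      then have "?G = ?H"
        using \<omega> by (intro N0(2)[OF _ G]) simp_all
      then show False
        using that by (simp add: perturbed_optimizer_def X'_def)
    qed
    then have "real (card ?D) \<le> (\<Sum>e\<in>?D. indicator (U e) \<omega> + indicator (U' e) \<omega>)"
      unfolding real_of_card by (intro sum_mono) (auto simp: indicator_def)
    also have "\<dots> \<le> Z \<omega>"
      unfolding Z_def using E by (intro sum_mono2) auto
    finally show ?thesis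
      using \<omega> by auto
  qed
  \<comment> \<open>The exceptional event joins the null set of ties to the Markov event; only this
    union has to be measurable.\<close>
  ultimately show ?thesis
    using N0(1) Zs by (intro bexI[of _ "N0 \<union> {\<omega> \<in> space M. Z \<omega> \<ge> t}"] conjI ballI) auto
qed

end

section \<open>Vanishing of the failure probability\<close>

theorem theorem3p4p4:
  fixes M :: "nat \<Rightarrow> 'a measure"
    and p :: "nat \<Rightarrow> nat"
    and \<G> :: "nat \<Rightarrow> nat set set set"
    and f :: "real \<Rightarrow> real"
    and X :: "nat \<Rightarrow> nat set \<Rightarrow> 'a \<Rightarrow> real"
    and Y :: "nat \<Rightarrow> nat set \<Rightarrow> nat set \<Rightarrow> 'a \<Rightarrow> real"
  assumes problem: "symmetric_graph_problem p \<G>"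
    and prob_space: "\<And>n. prob_space (M n)"
    and f_measurable: "f \<in> borel_measurable borel"
    and f_nonneg: "\<And>x. f x \<ge> 0"
    and f_support: "\<And>x. x < 0 \<Longrightarrow> f x = 0"
    and finite_mean: "integrable (density lborel (\<lambda>x. ennreal (f x))) (\<lambda>x. x)"
    and rejection: "rejection_assumption f"
    and weights_indep:
      "\<And>n. prob_space.indep_vars (M n) (\<lambda>_. borel) (X n) (complete_edges (p n))"
    and weights_law:
      "\<And>n e. e \<in> complete_edges (p n) \<Longrightarrow> distributed (M n) lborel (X n e) (\<lambda>x. ennreal (f x))"
    and copies:
      "\<And>n l. l \<in> complete_edges (p n) \<Longrightarrow>
         independent_copy (M n) (complete_edges (p n)) (X n) (Y n l)"
  shows "stable_under_small_perturbations M X Y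
           (\<lambda>n. complete_edges (p n)) (\<lambda>n e. {e})
           (\<lambda>n. graph_dist (p n)) (\<lambda>n. optimal_graph (\<G> n))"
  unfolding stable_under_small_perturbations_def
proof (intro allI impI)
  fix \<epsilon> \<delta> :: real
  assume \<epsilon>: "\<epsilon> > 0" and \<delta>: "\<delta> > 0"
  let ?E = "\<lambda>n. complete_edges (p n)"
  \<comment> \<open>The threshold 2 serves for every \<epsilon> and \<delta>: outside an event of
    vanishing probability the minimal packing number is at most 1.\<close>
  let ?Q = "\<lambda>n. {\<omega> \<in> space (M n).
    real (MIN A \<in> {A. A \<subseteq> ?E n \<and> real (card A) > (1 - \<epsilon>) * real (card (?E n))}.
      packing_number (perturbed_optimizer (X n) (Y n) (\<lambda>e. {e}) (optimal_graph (\<G> n)) \<omega> ` A)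
        (graph_dist (p n)) \<epsilon>) \<ge> 2}"
  obtain B where B: "\<And>n G. G \<in> \<G> n \<Longrightarrow> real (card G) / real (p n) \<le> B"
    using problem unfolding symmetric_graph_problem_def by blast
  have \<G>: "\<G> n \<noteq> {}" "\<G> n \<subseteq> Pow (?E n)" for n
    using problem unfolding symmetric_graph_problem_def by auto
  have p: "filterlim p at_top sequentially"
    using problem unfolding symmetric_graph_problem_def by auto
  \<comment> \<open>This is \<open>2 * b / t\<close> with \<open>b = B * p n\<close>, the bound on
    the edges of a graph, and \<open>t\<close> equal to \<epsilon> times the number of labels. The
    condition \<open>p n \<ge> 2\<close> makes \<open>t\<close> positive and lets the denominator
    \<open>p n\<close> be cleared.\<close>
  have bound: "measure (M n) (?Q n) \<le> 2 * (B * p n) / (\<epsilon> * (p n choose 2))" if pn: "p n \<ge> 2" for n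
  proof -
    interpret prob_space "M n" by (rule prob_space)
    have no_atom: "prob {\<omega> \<in> space (M n). X n e \<omega> = c} = 0" if "e \<in> ?E n" for e c
    proof -
      have "AE x in lborel. x \<noteq> c"
        by (rule AE_lborel_singleton)
      then have "AE \<omega> in M n. X n e \<omega> \<noteq> c"
        by (subst distributed_AE2[OF weights_law[OF that]]) auto
      then show ?thesis
        using distributed_measurable[OF weights_law[OF that]]
        by (subst prob_eq_0) auto
    qed
    have t: "\<epsilon> * real (p n choose 2) > 0"
      using \<epsilon> pn by (simp add: zero_less_binomial)
    have b: "real (card G) \<le> B * p n" if "G \<in> \<G> n" for G
      using B[OF that] pn by (simp add: pos_divide_le_eq)
    obtain N where N: "N \<in> events" "prob N \<le> 2 * (B * p n) / (\<epsilon> * (p n choose 2))"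
      "\<And>\<omega>. \<omega> \<in> space (M n) - N \<Longrightarrow>
       real (card {e \<in> ?E n. perturbed_optimizer (X n) (Y n) (\<lambda>e. {e}) (optimal_graph (\<G> n)) \<omega> e
                     \<noteq> optimal_graph (\<G> n) (\<lambda>i. X n i \<omega>)}) < \<epsilon> * (p n choose 2)"
      using perturbed_optimizers_differ_bound[where X = "X n" and Y = "Y n", OF finite_complete_edges
          weights_indep no_atom copies \<G>(2,1) b t] by fast
    have Q_sub: "?Q n \<subseteq> N"
    proof (rule subsetI, rule ccontr)
      fix \<omega> assume \<omega>: "\<omega> \<in> ?Q n" "\<omega> \<notin> N"
      then show False
        using Min_packing_number_le_1[OF finite_complete_edges N(3)[of \<omega>, folded card_complete_edges],
            of "graph_dist (p n)"] by auto
    qed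
    show ?thesis
      using finite_measure_mono[OF Q_sub N(1)] N(2) by (rule order_trans)
  qed
  \<comment> \<open>The numerator is linear and the denominator quadratic in \<open>m\<close>: for
    \<open>m \<ge> 2\<close> the quotient is \<open>4 * B / (\<epsilon> * (m - 1))\<close>.
    Composition with \<open>p\<close>, which tends to infinity, gives the limit in
    \<open>n\<close>.\<close>
  have "filterlim (\<lambda>m::nat. 2 * (B * m) / (\<epsilon> * (m choose 2))) (nhds 0) at_top"
  proof (rule Lim_transform_eventually)
    have "filterlim (\<lambda>m. real m - 1) at_top sequentially"
      using filterlim_tendsto_add_at_top[OF tendsto_const filterlim_real_sequentially, of "-1"]
      by simp
    from tendsto_mult_left[OF tendsto_inverse_0_at_top[OF this], of "4 * B / \<epsilon>"]
    show "(\<lambda>m::nat. 4 * B / \<epsilon> * inverse (real m - 1)) \<longlonglongrightarrow> 0"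
      by simp
    show "\<forall>\<^sub>F m in sequentially. 4 * B / \<epsilon> * inverse (real m - 1) = 2 * (B * m) / (\<epsilon> * (m choose 2))"
      using eventually_ge_at_top[of 2]
    proof eventually_elim
      case (elim m)
      have choose: "real (m choose 2) = real m * (real m - 1) / 2"
        using elim by (simp add: choose_two real_of_nat_div of_nat_diff)
      show ?case
        unfolding choose using elim \<epsilon> by (simp add: field_simps)
    qed
  qed
  from order_tendstoD(2)[OF filterlim_compose[OF this p] \<delta>]
  have "\<forall>\<^sub>F n in sequentially. measure (M n) (?Q n) \<le> \<delta>"
    using p[unfolded filterlim_at_top, rule_format, of 2]
  proof eventually_elim
    case (elim n)
    then show ?case
      using bound[of n] by linarith
  qed
  then have "limsup (\<lambda>n. ereal (measure (M n) (?Q n))) \<le> ereal \<delta>"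
    by (intro Limsup_bounded) simp
  then show "\<exists>K::real. limsup (\<lambda>n. ereal (measure (M n)
      {\<omega> \<in> space (M n).
        real (MIN A \<in> {A. A \<subseteq> ?E n \<and> real (card A) > (1 - \<epsilon>) * real (card (?E n))}.
          packing_number (perturbed_optimizer (X n) (Y n) (\<lambda>e. {e}) (optimal_graph (\<G> n)) \<omega> ` A)
            (graph_dist (p n)) \<epsilon>) \<ge> K})) \<le> ereal \<delta>"
    by blast
qed

end
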